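(* Let $0<\varepsilon<1/100$. Neither $A_\varepsilon$ nor $\mathcal{A}_\varepsilon$ is weak locally $\mathcal{H}^1$-finite.
   Context: A set $A\subset\mathbb{R}^2$ is weak locally $\mathcal{H}^1$-finite if for each $y\in A$ there is a radius $\rho_y>0$ with $\mathcal{H}^1(B_{\rho_y}(y)\cap A)<\infty$, where $\mathcal{H}^1$ is one-dimensional Hausdorff measure and $B_\rho(y)$ the open ball. Triangular caps: for a segment $S=[a,b]\subset\mathbb{R}^2$ and $h>0$, an $h$-triangular cap on $S$ is the closed solid isosceles triangle with base $S$ and third vertex (apex) $\frac{a+b}{2}+c$, where $|c|=h$ and $c\perp b-a$. If $S$ is an edge of a previously constructed cap $T$, the side is chosen so that the new cap is contained in $T$; on the initial segment $[(0,0),(1,0)]$ the apex has positive second coordinate. Construction of $A_\varepsilon$: Let $A_0=A_{0,1}=[(0,0),(1,0)]$. Given $A_n=\bigcup_{i=1}^{2^n}A_{n,i}$, a polygonal curve from $(0,0)$ to $(1,0)$ whose segments are numbered consecutively from $(0,0)$ to $(1,0)$, let $T_{n,i}$ be the $2^{1-n}\varepsilon$-triangular cap on $A_{n,i}$, let $A_{n+1,2i-1},A_{n+1,2i}$ be the two edges of $T_{n,i}$ other than its base $A_{n,i}$, and let $A_{n+1}=\bigcup_{k=1}^{2^{n+1}}A_{n+1,k}$. Define $A_\varepsilon:=\overline{\bigcup_{n=1}^\infty A_n}\setminus\bigcup_{n=1}^\infty A_n$. Construction of $\mathcal{A}_\varepsilon$: Let $a_{n,i}$ be the apex of $T_{n,i}$.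 Set $e_1=(0,0)$, $e_2=(1,0)$ and $e_{2+i+\sum_{j=0}^{n-1}2^j}=a_{n,i}$ for $n\ge0$, $1\le i\le 2^n$. Set $\rho_1=\frac14 2^{-7}(1+7\cdot16\varepsilon^2)^{1/2}$ and $\rho_i=4^{1-i}\rho_1$. Let $r_1=\rho_1$, $r_2=\rho_2$, and for $i\ge3$, with $n\ge0$ the unique integer such that $2+\sum_{j=0}^n2^j\le i\le 1+\sum_{j=0}^{n+1}2^j$, let $r_i=\min\{\rho_i,\tfrac12 d(e_i,A_{n-1}\cup A_{n-2})\}$, where sets $A_k$ with $k<0$ are omitted (so $r_i=\rho_i$ when $n=0$). Define $\mathcal{A}_\varepsilon:=A_\varepsilon\setminus\bigcup_{i=1}^\infty B_{r_i}(e_i)$, with $B_r(e)$ open balls. *)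

theory Defs
  imports "HOL-Analysis.Analysis"
begin

section \<open>One-dimensional Hausdorff measure\<close>

text \<open>
  The normalisation is the usual one, in which a segment has its length as measure. Covers are
  indexed by the naturals; finite covers are included because sets of the cover may be empty.
  Boundedness has to be required explicitly, since \<^const>\<open>diameter\<close> is only
  meaningful on bounded sets.
\<close>

definition hausdorff1_pre :: "real \<Rightarrow> 'a::metric_space set \<Rightarrow> ennreal" where
  "hausdorff1_pre \<delta> A =
     (INF C \<in> {C :: nat \<Rightarrow> 'a set. A \<subseteq> (\<Union>k. C k) \<and> (\<forall>k. bounded (C k) \<and> diameter (C k) \<le> \<delta>)}.
        (\<Sum>k. ennreal (diameter (C k))))"

definition hausdorff1 :: "'a::metric_space set \<Rightarrow> ennreal" where
  "hausdorff1 A = (SUP \<delta> \<in> {0<..}. hausdorff1_pre \<delta> A)"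

definition weak_locally_H1_finite :: "'a::metric_space set \<Rightarrow> bool" where
  "weak_locally_H1_finite A \<longleftrightarrow> (\<forall>y\<in>A. \<exists>\<rho>>0. hausdorff1 (ball y \<rho> \<inter> A) < \<infinity>)"


section \<open>Triangular caps and the polygonal curves\<close>

type_synonym plane = "real ^ 2"

definition is_cap_apex :: "real \<Rightarrow> plane \<Rightarrow> plane \<Rightarrow> plane \<Rightarrow> bool" where
  "is_cap_apex h a b p \<longleftrightarrow> (\<exists>c. norm c = h \<and> orthogonal c (b - a) \<and> p = midpoint a b + c)"

text \<open>
  \<open>cap_data \<epsilon> n i\<close>, for \<open>1 \<le> i \<le> 2 ^ n\<close>, is the triple (starting point of \<open>A\<^bsub>n,i\<^esub>\<close>, apex of
  \<open>T\<^bsub>n,i\<^esub>\<close>, end point of \<open>A\<^bsub>n,i\<^esub>\<close>), segments being traversed from \<open>(0,0)\<close> to \<open>(1,0)\<close>. The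
  segment with index \<open>k\<close> at level \<open>n + 1\<close> is the first (\<open>k\<close> odd) or the second (\<open>k\<close> even) lateral
  edge of the cap with index \<open>(k + 1) div 2\<close> at level \<open>n\<close>.
\<close>

primrec cap_data :: "real \<Rightarrow> nat \<Rightarrow> nat \<Rightarrow> plane \<times> plane \<times> plane" where
  "cap_data \<epsilon> 0 = (\<lambda>i.
     let u = vector [0, 0]; v = vector [1, 0]
     in (u, (THE q. is_cap_apex (2 * \<epsilon>) u v q \<and> q $ 2 > 0), v))"
| "cap_data \<epsilon> (Suc n) = (\<lambda>k.
     let (a, p, b) = cap_data \<epsilon> n ((k + 1) div 2);
         (u, v) = (if odd k then (a, p) else (p, b))
     in (u,
         (THE q. is_cap_apex (2 / 2 ^ Suc n * \<epsilon>) u v q \<and>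
                 convex hull {u, v, q} \<subseteq> convex hull {a, b, p}),
         v))"

definition seg :: "real \<Rightarrow> nat \<Rightarrow> nat \<Rightarrow> plane set" where
  "seg \<epsilon> n i = (case cap_data \<epsilon> n i of (a, p, b) \<Rightarrow> closed_segment a b)"

definition apex :: "real \<Rightarrow> nat \<Rightarrow> nat \<Rightarrow> plane" where
  "apex \<epsilon> n i = (case cap_data \<epsilon> n i of (a, p, b) \<Rightarrow> p)"

definition curve :: "real \<Rightarrow> nat \<Rightarrow> plane set" where
  "curve \<epsilon> n = (\<Union>i\<in>{1..2 ^ n}. seg \<epsilon> n i)"

definition A_eps :: "real \<Rightarrow> plane set" where
  "A_eps \<epsilon> = closure (\<Union>n\<in>{1..}. curve \<epsilon> n) - (\<Union>n\<in>{1..}. curve \<epsilon> n)"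


section \<open>The set with balls around the vertices removed\<close>

text \<open>All sequences below are indexed from 1; the value at index 0 is irrelevant.\<close>

definition e_pt :: "real \<Rightarrow> nat \<Rightarrow> plane" where
  "e_pt \<epsilon> m =
     (if m = 1 then vector [0, 0]
      else if m = 2 then vector [1, 0]
      else (THE q. \<exists>n i. 1 \<le> i \<and> i \<le> 2 ^ n \<and> m = 2 + i + (\<Sum>j<n. 2 ^ j) \<and> q = apex \<epsilon> n i))"

definition rho :: "real \<Rightarrow> nat \<Rightarrow> real" where
  "rho \<epsilon> i = 4 powi (1 - int i) * (1 / 4 * 2 powi (-7) * sqrt (1 + 7 * 16 * \<epsilon>\<^sup>2))"

definition r_level :: "nat \<Rightarrow> nat" where
  "r_level i = (THE n. 2 + (\<Sum>j\<le>n. 2 ^ j) \<le> i \<and> i \<le> 1 + (\<Sum>j\<le>n + 1. 2 ^ j))"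

text \<open>
  The union below consists of the curves of levels \<open>n - 1\<close> and \<open>n - 2\<close>, negative levels being
  omitted. The case \<open>n = 0\<close> is separate because \<^term>\<open>infdist x {} = 0\<close>.
\<close>

definition r_rad :: "real \<Rightarrow> nat \<Rightarrow> real" where
  "r_rad \<epsilon> i =
     (if i \<le> 2 then rho \<epsilon> i
      else let n = r_level i in
        if n = 0 then rho \<epsilon> i
        else min (rho \<epsilon> i)
               (1 / 2 * infdist (e_pt \<epsilon> i) (\<Union>k\<in>{k. k + 1 = n \<or> k + 2 = n}. curve \<epsilon> k)))"

definition calA_eps :: "real \<Rightarrow> plane set" where
  "calA_eps \<epsilon> = A_eps \<epsilon> - (\<Union>i\<in>{1..}. ball (e_pt \<epsilon> i) (r_rad \<epsilon> i))"

end

theory Submission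
  imports Defs
begin

text \<open>
  The segments of level \<open>n\<close> have length \<open>2\<^sup>-\<^sup>n g\<^sub>n\<close> with \<open>g\<^sub>n = (1 + 16 n \<epsilon>\<^sup>2)\<^sup>1\<^sup>/\<^sup>2\<close>, which is
  unbounded. Let \<open>f t\<close> be a common point of the nested caps addressed by the binary digits of
  \<open>t \<in> [0,1)\<close>. Two sibling caps leave their common apex in nearly opposite directions, and a cap is at
  distance comparable to \<open>2\<^sup>-\<^sup>n g\<^sub>n\<close> from the far endpoint of its sibling. Hence
  \<open>|f s - f t| \<ge> (9/20) g\<^sub>M |s - t|\<close> whenever \<open>|s - t| < 2\<^sup>-\<^sup>M\<close>. By mass distribution, a set of finite
  \<open>H\<^sup>1\<close> has a Lebesgue null preimage under \<open>f\<close>, and by the Lindeloef property so has every weak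
  locally \<open>H\<^sup>1\<close>-finite set. In particular the preimages of the polygonal curves are null, while the
  case \<open>M = 0\<close> shows that the preimages of the removed balls have total measure less than \<open>1\<close>; only
  \<open>r\<^sub>i \<le> \<rho>\<^sub>i\<close> matters here, not the centres. So the preimage of the smaller of the two sets is not null.
\<close>

section \<open>Geometry of the caps\<close>

text \<open>Counterclockwise quarter turn. It describes a cap by its base and one signed number, the
  ratio of height to base, whose sign records the side of the base.\<close>

definition rot :: "plane \<Rightarrow> plane" where
  "rot x = vector [- (x $ 2), x $ 1]"

lemma rot_add: "rot (x + y) = rot x + rot y"
  and rot_diff: "rot (x - y) = rot x - rot y"
  and rot_scaleR: "rot (c *\<^sub>R x) = c *\<^sub>R rot x"
  and rot_rot: "rot (rot x) = - x"
  by (simp_all add: rot_def vec_eq_iff forall_2)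

lemma inner_rot_self: "x \<bullet> rot x = 0" "rot x \<bullet> x = 0"
  and inner_rot_rot: "rot x \<bullet> rot y = x \<bullet> y"
  by (simp_all add: rot_def inner_vec_def sum_2)

lemma norm_rot: "norm (rot x) = norm x"
  by (simp add: norm_eq_sqrt_inner inner_rot_rot)

lemma orthogonal_plane_eq_rot:
  fixes c d :: plane
  assumes "orthogonal c d" and "d \<noteq> 0"
  obtains k where "c = k *\<^sub>R rot d"
proof
  have dd: "d \<bullet> d \<noteq> 0" using assms(2) by simp
  have *: "c $ 1 * d $ 1 = - (c $ 2 * d $ 2)"
    using assms(1) by (simp add: orthogonal_def inner_vec_def sum_2)
  have "(d \<bullet> d) *\<^sub>R c = (c \<bullet> rot d) *\<^sub>R rot d"
    using * by (simp add: vec_eq_iff forall_2 rot_def inner_vec_def sum_2) algebra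
  then have "(1 / (d \<bullet> d)) *\<^sub>R ((d \<bullet> d) *\<^sub>R c) = (1 / (d \<bullet> d)) *\<^sub>R ((c \<bullet> rot d) *\<^sub>R rot d)"
    by simp
  then show "c = ((c \<bullet> rot d) / (d \<bullet> d)) *\<^sub>R rot d"
    using dd by simp
qed

text \<open>There is one candidate on each side of the segment. Writing the height as
  \<open>\<bar>k\<bar>\<close> times the base turns the choice of side into the choice of a
  sign.\<close>

lemma is_cap_apex_iff:
  assumes "u \<noteq> v" and "h = \<bar>k\<bar> * norm (v - u)"
  shows "is_cap_apex h u v q \<longleftrightarrow>
    q = midpoint u v + k *\<^sub>R rot (v - u) \<or> q = midpoint u v - k *\<^sub>R rot (v - u)"
proof
  assume "is_cap_apex h u v q"
  then obtain c where c: "norm c = h" "orthogonal c (v - u)" "q = midpoint u v + c"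
    unfolding is_cap_apex_def by blast
  obtain j where j: "c = j *\<^sub>R rot (v - u)"
    using orthogonal_plane_eq_rot[OF c(2)] assms(1) by auto
  have "\<bar>j\<bar> = \<bar>k\<bar>"
    using c(1) j assms by (simp add: norm_rot)
  then have "j = k \<or> j = - k" by (simp add: abs_eq_iff)
  then show "q = midpoint u v + k *\<^sub>R rot (v - u) \<or> q = midpoint u v - k *\<^sub>R rot (v - u)"
    using c(3) j by auto
next
  have o: "orthogonal (j *\<^sub>R rot (v - u)) (v - u)" for j
    by (simp add: orthogonal_def inner_rot_self)
  assume "q = midpoint u v + k *\<^sub>R rot (v - u) \<or> q = midpoint u v - k *\<^sub>R rot (v - u)"
  then have "q = midpoint u v + k *\<^sub>R rot (v - u) \<or> q = midpoint u v + (- k) *\<^sub>R rot (v - u)"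
    by simp
  then show "is_cap_apex h u v q"
  proof
    assume "q = midpoint u v + k *\<^sub>R rot (v - u)"
    then show ?thesis unfolding is_cap_apex_def using o assms(2)
      by (intro exI[of _ "k *\<^sub>R rot (v - u)"]) (simp add: norm_rot)
  next
    assume "q = midpoint u v + (- k) *\<^sub>R rot (v - u)"
    then show ?thesis unfolding is_cap_apex_def using o assms(2)
      by (intro exI[of _ "(- k) *\<^sub>R rot (v - u)"]) (auto simp add: norm_rot simp del: scaleR_minus_left)
  qed
qed

lemma is_cap_apex_commute: "is_cap_apex h u v q \<longleftrightarrow> is_cap_apex h v u q"
proof -
  have "orthogonal c (v - u) \<longleftrightarrow> orthogonal c (u - v)" for c
    by (auto simp: orthogonal_def inner_diff_right)
  then show ?thesis by (simp only: is_cap_apex_def midpoint_sym[of u v])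
qed

lemma midpoint_eq_add: "midpoint a b = a + (1 / 2) *\<^sub>R (b - a)"
proof -
  have "midpoint a b = (1 / 2) *\<^sub>R (a + b)" by (simp add: midpoint_def)
  also have "\<dots> = (1 / 2) *\<^sub>R (a + a) + (1 / 2) *\<^sub>R (b - a)" by (simp add: algebra_simps)
  finally show ?thesis by (simp only: scaleR_half_double)
qed

text \<open>Reading a cap from \<open>b\<close> to \<open>a\<close> flips the sign of its slope, so
  facts about the first child of a cap carry over to the second.\<close>

lemma apex_reverse:
  "midpoint a b + s *\<^sub>R rot (b - a) = midpoint b a + (- s) *\<^sub>R rot (a - b)"
proof -
  have "s *\<^sub>R rot (b - a) = (- s) *\<^sub>R rot (a - b)"
    by (simp add: rot_diff scaleR_diff_right)
  then show ?thesis by (simp only: midpoint_sym[of a b])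
qed

section \<open>Position of a new apex relative to the previous cap\<close>

lemma inner_cap_apex_mem:
  fixes a b p q :: plane and s s' :: real
  assumes p: "p = midpoint a b + s *\<^sub>R rot (b - a)"
    and q: "q = midpoint a p + s' *\<^sub>R rot (p - a)"
    and s: "s * s' < 0" "\<bar>s'\<bar> \<le> \<bar>s\<bar>" "\<bar>s\<bar> \<le> 1 / 2"
  shows "q \<in> convex hull {a, b, p}"
proof -
  \<comment> \<open>\<open>\<beta>\<close> and \<open>\<gamma>\<close> are the barycentric
    coordinates of \<open>q\<close> at \<open>b\<close> and \<open>p\<close>, found by comparing
    components along \<open>b - a\<close> and \<open>rot (b - a)\<close>.\<close>
  define \<gamma> where "\<gamma> = (s + s') / (2 * s)"
  define \<beta> where "\<beta> = 1 / 4 - s * s' - \<gamma> / 2"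
  have s0: "s \<noteq> 0" using s by auto
  have quot: "- 1 \<le> s' / s" "s' / s < 0"
    using s s0 by (auto simp: field_simps abs_if mult_less_0_iff split: if_splits)
  have g: "\<gamma> = 1 / 2 + (s' / s) / 2" using s0 by (simp add: \<gamma>_def field_simps)
  have "\<bar>s * s'\<bar> \<le> 1 / 2 * (1 / 2)" unfolding abs_mult using s by (intro mult_mono) auto
  then have ss: "- (1 / 4) \<le> s * s'" by linarith
  have g0: "0 \<le> \<gamma>" "\<gamma> \<le> 1 / 2" using g quot by auto
  have b0: "0 \<le> \<beta>" using quot s(1) by (simp add: \<beta>_def g)
  have a0: "0 \<le> 1 - \<beta> - \<gamma>" using g0 ss by (simp add: \<beta>_def)
  have sg: "\<gamma> * s = s / 2 + s' / 2" using s0 by (simp add: \<gamma>_def field_simps)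
  define d where "d = b - a"
  have b: "b = a + d" by (simp add: d_def)
  have p': "p = a + (1/2) *\<^sub>R d + s *\<^sub>R rot d"
    unfolding p b by (simp add: midpoint_eq_add)
  have rp: "rot (p - a) = (1/2) *\<^sub>R rot d - s *\<^sub>R d"
    by (simp add: p' rot_add rot_scaleR rot_rot)
  have "q = a + (1/2) *\<^sub>R (p - a) + s' *\<^sub>R rot (p - a)"
    unfolding q by (simp add: midpoint_eq_add)
  also have "\<dots> = a + (1/4 - s * s') *\<^sub>R d + (s / 2 + s' / 2) *\<^sub>R rot d"
    unfolding rp by (simp add: p' algebra_simps)
  also have "\<dots> = a + (\<beta> + \<gamma> / 2) *\<^sub>R d + (\<gamma> * s) *\<^sub>R rot d"
    unfolding sg by (simp add: \<beta>_def)
  also have "\<dots> = (1 - \<beta> - \<gamma>) *\<^sub>R a + \<beta> *\<^sub>R b + \<gamma> *\<^sub>R p"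
    unfolding b p' by (simp add: algebra_simps)
  finally show ?thesis unfolding convex_hull_3
    using a0 b0 g0(1) by (intro CollectI exI[of _ "1 - \<beta> - \<gamma>"] exI[of _ \<beta>] exI[of _ \<gamma>]) simp
qed

text \<open>The line through \<open>a\<close> and \<open>p\<close> separates. The factor
  \<open>s\<close> in its normal \<open>n\<close> makes \<open>n\<close> point away from
  \<open>b\<close> for either sign of \<open>s\<close>; the triangle is on the nonpositive side and
  \<open>q\<close> strictly on the positive one.\<close>

lemma outer_cap_apex_notin:
  fixes a b p q :: plane and s s' :: real
  assumes p: "p = midpoint a b + s *\<^sub>R rot (b - a)"
    and q: "q = midpoint a p - s' *\<^sub>R rot (p - a)"
    and s: "s * s' < 0" and ab: "a \<noteq> b"
  shows "q \<notin> convex hull {a, b, p}"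
proof
  assume q_in: "q \<in> convex hull {a, b, p}"
  define d where "d = b - a"
  define n where "n = s *\<^sub>R rot (p - a)"
  have b: "b = a + d" by (simp add: d_def)
  have p': "p = a + (1/2) *\<^sub>R d + s *\<^sub>R rot d"
    unfolding p b by (simp add: midpoint_eq_add)
  have rp: "rot (p - a) = (1/2) *\<^sub>R rot d - s *\<^sub>R d"
    by (simp add: p' rot_add rot_scaleR rot_rot)
  have q': "q - a = (1/2) *\<^sub>R (p - a) - s' *\<^sub>R rot (p - a)"
    unfolding q by (simp add: midpoint_eq_add)
  have "d \<bullet> n = - (s * s) * (d \<bullet> d)"
    unfolding n_def rp by (simp add: inner_diff_right inner_rot_self)
  then have bn: "d \<bullet> n \<le> 0" by (simp add: mult_nonneg_nonneg)
  have pn: "(p - a) \<bullet> n = 0" by (simp add: n_def inner_rot_self)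
  have "{a, b, p} \<subseteq> {x. n \<bullet> x \<le> n \<bullet> a}"
    using bn pn by (auto simp: b inner_add_right inner_diff_right inner_commute[of _ n])
  then have "convex hull {a, b, p} \<subseteq> {x. n \<bullet> x \<le> n \<bullet> a}"
    by (intro hull_minimal convex_halfspace_le)
  then have "(q - a) \<bullet> n \<le> 0"
    using q_in by (auto simp: inner_diff_left inner_commute[of n])
  moreover have "(q - a) \<bullet> n = - (s * s') * ((p - a) \<bullet> (p - a))"
    unfolding q' n_def by (simp add: inner_diff_left inner_rot_self inner_rot_rot)
  moreover have "p \<noteq> a"
  proof
    assume "p = a"
    then have "rot (p - a) \<bullet> d = 0" by (simp add: rot_def inner_vec_def sum_2)
    then have "s * (d \<bullet> d) = 0" unfolding rp by (simp add: inner_diff_left inner_rot_self)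
    then show False using s ab by (auto simp: d_def)
  qed
  moreover have "0 < - (s * s') * ((p - a) \<bullet> (p - a))"
    using s \<open>p \<noteq> a\<close> by (intro mult_pos_pos) auto
  ultimately show False by simp
qed

text \<open>Evaluates the definite description in \<open>cap_data\<close>: containment in the parent
  selects the slope of opposite sign.\<close>

lemma the_inner_cap_apex:
  fixes a b p :: plane and s s' :: real
  assumes p: "p = midpoint a b + s *\<^sub>R rot (b - a)" and ab: "a \<noteq> b"
    and s: "s * s' < 0" "\<bar>s'\<bar> \<le> \<bar>s\<bar>" "\<bar>s\<bar> \<le> 1 / 2"
    and uv: "(u, v) = (a, p) \<or> (u, v) = (p, b)"
    and h: "h = \<bar>s'\<bar> * norm (v - u)"
  shows "(THE q. is_cap_apex h u v q \<and> convex hull {u, v, q} \<subseteq> convex hull {a, b, p})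
           = midpoint u v + s' *\<^sub>R rot (v - u)" (is ?eq)
    and "convex hull {u, v, midpoint u v + s' *\<^sub>R rot (v - u)} \<subseteq> convex hull {a, b, p}" (is ?sub)
proof -
  \<comment> \<open>Stated for either end \<open>x\<close> of the base: \<open>x = a\<close> gives
    the first child and \<open>x = b\<close>, with both slopes negated, the second.\<close>
  have first: "is_cap_apex h x p q \<and> convex hull {x, p, q} \<subseteq> convex hull {x, y, p}
        \<longleftrightarrow> q = midpoint x p + r' *\<^sub>R rot (p - x)"
    if p: "p = midpoint x y + r *\<^sub>R rot (y - x)" and xy: "x \<noteq> y"
    and r: "r * r' < 0" "\<bar>r'\<bar> \<le> \<bar>r\<bar>" "\<bar>r\<bar> \<le> 1 / 2"
    and h: "h = \<bar>r'\<bar> * norm (p - x)" for x y :: plane and r r' q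
  proof -
    \<comment> \<open>Two corners already lie in the parent, so only the new apex has to be
      tested.\<close>
    have sub: "convex hull {x, p, q} \<subseteq> convex hull {x, y, p} \<longleftrightarrow> q \<in> convex hull {x, y, p}"
      by (simp add: hull_inc subset_hull)
    have "x \<noteq> p"
    proof
      assume "x = p"
      then have "0 = (midpoint x y + r *\<^sub>R rot (y - x) - x) \<bullet> (y - x)" using p by simp
      also have "\<dots> = (midpoint x y - x) \<bullet> (y - x)"
        by (simp add: inner_add_left inner_diff_left[of _ x] inner_rot_self)
      also have "\<dots> = (y - x) \<bullet> (y - x) / 2"
        by (simp add: midpoint_eq_add)
      finally show False using xy by simp
    qed
    then show ?thesis
      unfolding sub is_cap_apex_iff[OF \<open>x \<noteq> p\<close> h]
      using inner_cap_apex_mem[OF p _ r] outer_cap_apex_notin[OF p _ r(1) xy] by blast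
  qed
  have *: "is_cap_apex h u v q \<and> convex hull {u, v, q} \<subseteq> convex hull {a, b, p}
        \<longleftrightarrow> q = midpoint u v + s' *\<^sub>R rot (v - u)" for q
    using uv
  proof
    assume "(u, v) = (a, p)"
    then show ?thesis using first[OF p ab s] h by simp
  next
    assume uv: "(u, v) = (p, b)"
    have p': "p = midpoint b a + (- s) *\<^sub>R rot (a - b)"
      unfolding p by (rule apex_reverse)
    have "is_cap_apex h b p q \<and> convex hull {b, p, q} \<subseteq> convex hull {b, a, p}
        \<longleftrightarrow> q = midpoint b p + (- s') *\<^sub>R rot (p - b)"
      using uv s h ab by (intro first[OF p']) (auto simp: norm_minus_commute)
    then show ?thesis using uv
      by (simp add: is_cap_apex_commute[of h b] insert_commute midpoint_sym rot_diff algebra_simps)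
  qed
  show ?eq unfolding * by simp
  show ?sub using * by blast
qed

text \<open>The norm is convex and the inner product linear. Hence a triangle lies in the cone as
  soon as its corners do.\<close>

lemma convex_cone_condition:
  fixes p d :: "'a::real_inner"
  assumes "0 \<le> c"
  shows "convex {x. c * norm (p - x) * norm d \<le> (p - x) \<bullet> d}"
  unfolding convex_def
proof (clarsimp)
  fix x y :: 'a and u v :: real
  assume x: "c * norm (p - x) * norm d \<le> (p - x) \<bullet> d"
    and y: "c * norm (p - y) * norm d \<le> (p - y) \<bullet> d"
    and uv: "0 \<le> u" "0 \<le> v" "u + v = 1"
  have "p = u *\<^sub>R p + v *\<^sub>R p" using uv by (simp flip: scaleR_add_left)
  then have eq: "p - (u *\<^sub>R x + v *\<^sub>R y) = u *\<^sub>R (p - x) + v *\<^sub>R (p - y)"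
    by (simp add: algebra_simps)
  have "norm (p - (u *\<^sub>R x + v *\<^sub>R y)) \<le> u * norm (p - x) + v * norm (p - y)"
    unfolding eq using norm_triangle_ineq[of "u *\<^sub>R (p - x)" "v *\<^sub>R (p - y)"] uv by simp
  then have "c * norm d * norm (p - (u *\<^sub>R x + v *\<^sub>R y))
      \<le> c * norm d * (u * norm (p - x) + v * norm (p - y))"
    using assms by (intro mult_left_mono) auto
  also have "\<dots> = u * (c * norm (p - x) * norm d) + v * (c * norm (p - y) * norm d)"
    by (simp add: algebra_simps)
  also have "\<dots> \<le> u * ((p - x) \<bullet> d) + v * ((p - y) \<bullet> d)"
    using x y uv by (intro add_mono mult_left_mono) auto
  also have "\<dots> = (p - (u *\<^sub>R x + v *\<^sub>R y)) \<bullet> d"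
    unfolding eq by (simp add: inner_add_left)
  finally show "c * norm (p - (u *\<^sub>R x + v *\<^sub>R y)) * norm d \<le> (p - (u *\<^sub>R x + v *\<^sub>R y)) \<bullet> d"
    by (simp add: mult_ac)
qed

text \<open>A child cap lies in a cone around the base direction of its parent, with vertex at the
  apex of the parent. This makes the two children of a cap transversal.\<close>

lemma child_cap_cone:
  fixes a b p q x :: plane
  assumes p: "p = midpoint a b + s *\<^sub>R rot (b - a)"
    and q: "q = midpoint a p + s' *\<^sub>R rot (p - a)"
    and s: "\<bar>s\<bar> \<le> 1 / 50" "\<bar>s'\<bar> \<le> 1 / 50"
    and x: "x \<in> convex hull {a, p, q}"
  shows "9 / 10 * norm (p - x) * norm (b - a) \<le> (p - x) \<bullet> (b - a)"
    and "norm (b - a) / 2 \<le> norm (b - x)"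
proof -
  define d where "d = b - a"
  have b: "b = a + d" by (simp add: d_def)
  have pa: "p - a = (1/2) *\<^sub>R d + s *\<^sub>R rot d"
    unfolding p b by (simp add: midpoint_eq_add)
  have rp: "rot (p - a) = (1/2) *\<^sub>R rot d - s *\<^sub>R d"
    by (simp add: pa rot_add rot_scaleR rot_rot)
  have pq: "p - q = (1/2) *\<^sub>R (p - a) - s' *\<^sub>R rot (p - a)"
  proof -
    have "(1/2) *\<^sub>R (p - a) + (1/2) *\<^sub>R (p - a) = p - a" by (simp flip: scaleR_add_left)
    then have "p - q = ((1/2) *\<^sub>R (p - a) + (1/2) *\<^sub>R (p - a)) + a - q" by simp
    then show ?thesis
      by (simp only: q midpoint_eq_add add_diff_cancel_left diff_diff_eq[symmetric]
          add_diff_cancel_right' add.commute[of a]) simp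
  qed
  have "\<bar>s * s'\<bar> \<le> 1 / 50 * (1 / 50)" unfolding abs_mult using s by (intro mult_mono) auto
  then have ss: "- (1 / 2500) \<le> s * s'" "s * s' \<le> 1 / 2500" by linarith+
  have pad: "(p - a) \<bullet> d = 1 / 2 * (d \<bullet> d)"
    unfolding pa by (simp add: inner_add_left inner_rot_self)
  have pqd: "(p - q) \<bullet> d = (1 / 4 + s * s') * (d \<bullet> d)"
    unfolding pq rp using pad by (simp add: inner_add_left inner_diff_left inner_rot_self algebra_simps)
  \<comment> \<open>The factor \<open>52 / 100\<close> is \<open>1 / 2 + 1 / 50\<close>, and
    \<open>2704 / 10000\<close> is its square. The cone condition at \<open>a\<close> and
    \<open>q\<close> comes down to \<open>9 / 10 * 52 / 100 \<le> 1 / 2\<close> and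
    \<open>24336 / 100000 \<le> 1 / 4 - 1 / 2500\<close>.\<close>
  have npa: "norm (p - a) \<le> 52 / 100 * norm d"
  proof -
    have "norm (p - a) \<le> norm ((1/2) *\<^sub>R d) + norm (s *\<^sub>R rot d)"
      unfolding pa by (rule norm_triangle_ineq)
    also have "\<dots> = (1 / 2 + \<bar>s\<bar>) * norm d" by (simp add: norm_rot algebra_simps)
    also have "\<dots> \<le> 52 / 100 * norm d" using s by (intro mult_right_mono) auto
    finally show ?thesis .
  qed
  have npq: "norm (p - q) \<le> 2704 / 10000 * norm d"
  proof -
    have "norm (p - q) \<le> norm ((1/2) *\<^sub>R (p - a)) + norm (s' *\<^sub>R rot (p - a))"
      unfolding pq by (rule norm_triangle_ineq4)
    also have "\<dots> = (1 / 2 + \<bar>s'\<bar>) * norm (p - a)"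
      by (simp add: norm_rot distrib_right del: scaleR_diff_right)
    also have "\<dots> \<le> 52 / 100 * (52 / 100 * norm d)" using s npa by (intro mult_mono) auto
    finally show ?thesis by simp
  qed
  have dd: "d \<bullet> d = norm d * norm d" by (metis power2_norm_eq_inner power2_eq_square)
  have "9 / 10 * norm (p - a) * norm d \<le> 9 / 10 * (52 / 100 * norm d) * norm d"
    using npa by (intro mult_right_mono mult_left_mono) auto
  also have "\<dots> \<le> 1 / 2 * (norm d * norm d)" by simp
  finally have 1: "9 / 10 * norm (p - a) * norm d \<le> (p - a) \<bullet> d" unfolding pad dd .
  have "9 / 10 * norm (p - q) * norm d \<le> 9 / 10 * (2704 / 10000 * norm d) * norm d"
    using npq by (intro mult_right_mono mult_left_mono) auto
  also have "\<dots> = 24336 / 100000 * (norm d * norm d)" by simp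
  also have "\<dots> \<le> (1 / 4 + s * s') * (norm d * norm d)" using ss by (intro mult_right_mono) auto
  finally have 2: "9 / 10 * norm (p - q) * norm d \<le> (p - q) \<bullet> d" unfolding pqd dd .
  have "convex hull {a, p, q} \<subseteq> {x. 9 / 10 * norm (p - x) * norm d \<le> (p - x) \<bullet> d}"
    using 1 2 by (intro hull_minimal convex_cone_condition) auto
  then show "9 / 10 * norm (p - x) * norm (b - a) \<le> (p - x) \<bullet> (b - a)"
    using x by (auto simp: d_def)
  \<comment> \<open>\<open>p\<close> projects to the midpoint of the base, so \<open>x\<close> does
    not lie beyond the perpendicular bisector on the side of \<open>b\<close>.\<close>
  have "0 \<le> (p - x) \<bullet> d"
    using \<open>9 / 10 * norm (p - x) * norm (b - a) \<le> (p - x) \<bullet> (b - a)\<close>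
    by (simp add: d_def) (smt (verit) norm_ge_zero mult_nonneg_nonneg)
  moreover have "(b - p) \<bullet> d = 1 / 2 * (d \<bullet> d)"
    using pad by (simp add: b inner_diff_left inner_add_left)
  ultimately have "1 / 2 * (norm d * norm d) \<le> (b - x) \<bullet> d"
    unfolding dd by (simp add: inner_diff_left)
  also have "\<dots> \<le> norm (b - x) * norm d" by (rule norm_cauchy_schwarz)
  finally show "norm (b - a) / 2 \<le> norm (b - x)"
    unfolding d_def[symmetric] by (cases "d = 0") (simp_all add: field_simps)
qed

section \<open>Lengths and slopes at each level\<close>

definition stretch :: "real \<Rightarrow> nat \<Rightarrow> real" where
  "stretch \<epsilon> n = sqrt (1 + 16 * real n * \<epsilon>\<^sup>2)"

text \<open>The signed ratio of height to base of the caps of level \<open>n\<close>. The sign alternates because a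
  cap lies inside its parent, hence on the other side of the curve.\<close>

definition slope :: "real \<Rightarrow> nat \<Rightarrow> real" where
  "slope \<epsilon> n = (- 1) ^ n * (2 * \<epsilon> / stretch \<epsilon> n)"

definition cap :: "real \<Rightarrow> nat \<Rightarrow> nat \<Rightarrow> plane set" where
  "cap \<epsilon> n i = (case cap_data \<epsilon> n i of (a, p, b) \<Rightarrow> convex hull {a, b, p})"

lemma stretch_0 [simp]: "stretch \<epsilon> 0 = 1"
  by (simp add: stretch_def)

lemma stretch_ge_1: "1 \<le> stretch \<epsilon> n"
  by (simp add: stretch_def)

lemma stretch_pos: "0 < stretch \<epsilon> n"
  using stretch_ge_1[of \<epsilon> n] by linarith

lemma stretch_mono: "m \<le> n \<Longrightarrow> stretch \<epsilon> m \<le> stretch \<epsilon> n"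
  by (auto simp: stretch_def intro!: mult_right_mono)

lemma stretch_unbounded:
  assumes "0 < \<epsilon>"
  obtains n where "K < stretch \<epsilon> n"
proof -
  obtain n where n: "K\<^sup>2 / (16 * \<epsilon>\<^sup>2) < real n" using reals_Archimedean2 by blast
  then have "K\<^sup>2 < 1 + 16 * real n * \<epsilon>\<^sup>2" using assms by (simp add: field_simps)
  then have "K < stretch \<epsilon> n" unfolding stretch_def by (rule real_less_rsqrt)
  then show thesis by (rule that)
qed

text \<open>By Pythagoras a lateral edge is \<open>sqrt (1 + 4 * s\<^sup>2) / 2\<close> times the
  base. With slope \<open>2 * \<epsilon>\<close> over \<open>stretch\<close> (the
  \<open>g\<^sub>n\<close> of the overview), this adds \<open>16 * \<epsilon>\<^sup>2\<close> to the
  square of \<open>stretch\<close> at each level.\<close>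

lemma stretch_Suc: "stretch \<epsilon> (Suc n) = sqrt (1 + 4 * (slope \<epsilon> n)\<^sup>2) * stretch \<epsilon> n"
proof -
  have g: "(stretch \<epsilon> n)\<^sup>2 = 1 + 16 * real n * \<epsilon>\<^sup>2" by (simp add: stretch_def)
  have sl: "(slope \<epsilon> n)\<^sup>2 = 4 * \<epsilon>\<^sup>2 / (stretch \<epsilon> n)\<^sup>2"
    by (simp add: slope_def power_mult_distrib power_divide power2_eq_square[of "(- 1) ^ n"]
        flip: power_mult_distrib[of "- 1" "- 1"])
  have "(1 + 4 * (slope \<epsilon> n)\<^sup>2) * (stretch \<epsilon> n)\<^sup>2 = (stretch \<epsilon> n)\<^sup>2 + 16 * \<epsilon>\<^sup>2"
    unfolding sl using stretch_pos[of \<epsilon> n] by (simp add: field_simps)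
  also have "\<dots> = 1 + 16 * real (Suc n) * \<epsilon>\<^sup>2" unfolding g by (simp add: algebra_simps)
  finally have "stretch \<epsilon> (Suc n) = sqrt ((1 + 4 * (slope \<epsilon> n)\<^sup>2) * (stretch \<epsilon> n)\<^sup>2)"
    by (simp only: stretch_def)
  then show ?thesis using stretch_pos[of \<epsilon> n] by (simp add: real_sqrt_mult)
qed

lemma norm_lateral_edge:
  fixes d :: plane
  shows "norm ((1 / 2) *\<^sub>R d + s *\<^sub>R rot d) = sqrt (1 + 4 * s\<^sup>2) * norm d / 2"
proof -
  have "((1 / 2) *\<^sub>R d + s *\<^sub>R rot d) \<bullet> ((1 / 2) *\<^sub>R d + s *\<^sub>R rot d) = (1 + 4 * s\<^sup>2) / 4 * (d \<bullet> d)"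
    by (simp add: inner_add_left inner_add_right inner_rot_self inner_rot_rot power2_eq_square algebra_simps)
  then show ?thesis
    unfolding norm_eq_sqrt_inner by (simp only: real_sqrt_mult real_sqrt_divide real_sqrt_four)
qed

text \<open>These are the numerical hypotheses of the cap lemmas. The slopes shrink because
  \<open>stretch\<close> grows, and \<open>1 / 50\<close> is twice the bound on \<epsilon>.\<close>

lemma slope_props:
  assumes "0 < \<epsilon>" "\<epsilon> < 1 / 100"
  shows "\<bar>slope \<epsilon> n\<bar> = 2 * \<epsilon> / stretch \<epsilon> n" and "\<bar>slope \<epsilon> n\<bar> \<le> 1 / 50"
    and "\<bar>slope \<epsilon> (Suc n)\<bar> \<le> \<bar>slope \<epsilon> n\<bar>" and "slope \<epsilon> n * slope \<epsilon> (Suc n) < 0"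
proof -
  have pos: "0 < 2 * \<epsilon> / stretch \<epsilon> n" for n using assms stretch_pos[of \<epsilon> n] by simp
  have abs: "\<bar>slope \<epsilon> n\<bar> = 2 * \<epsilon> / stretch \<epsilon> n" for n
    using abs_of_pos[OF pos[of n]] by (simp only: slope_def abs_mult power_abs) simp
  show "\<bar>slope \<epsilon> n\<bar> = 2 * \<epsilon> / stretch \<epsilon> n" by (rule abs)
  show "\<bar>slope \<epsilon> (Suc n)\<bar> \<le> \<bar>slope \<epsilon> n\<bar>"
    unfolding abs using assms stretch_mono[of n "Suc n" \<epsilon>] stretch_pos[of \<epsilon> n]
    by (intro divide_left_mono) auto
  have "2 * \<epsilon> / stretch \<epsilon> n \<le> 2 * \<epsilon> / 1"
    using assms stretch_ge_1[of \<epsilon> n] by (intro divide_left_mono) auto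
  then show "\<bar>slope \<epsilon> n\<bar> \<le> 1 / 50" unfolding abs using assms by simp
  have "slope \<epsilon> n * slope \<epsilon> (Suc n)
      = - ((- 1) ^ n * (- 1) ^ n) * ((2 * \<epsilon> / stretch \<epsilon> n) * (2 * \<epsilon> / stretch \<epsilon> (Suc n)))"
    unfolding slope_def by simp
  also have "\<dots> = - ((2 * \<epsilon> / stretch \<epsilon> n) * (2 * \<epsilon> / stretch \<epsilon> (Suc n)))"
    by (simp flip: power_mult_distrib)
  also have "\<dots> < 0" using mult_pos_pos[OF pos pos] by simp
  finally show "slope \<epsilon> n * slope \<epsilon> (Suc n) < 0" .
qed

lemma cap_data_0:
  assumes "0 < \<epsilon>"
  shows "cap_data \<epsilon> 0 i = (vector [0, 0], midpoint (vector [0, 0]) (vector [1, 0])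
    + slope \<epsilon> 0 *\<^sub>R rot (vector [1, 0] - vector [0, 0]), vector [1, 0])"
proof -
  define u v :: plane where "u = vector [0, 0]" and "v = vector [1, 0]"
  have uv: "u \<noteq> v" by (simp add: u_def v_def vec_eq_iff forall_2)
  have "norm (v - u) = 1" by (simp add: u_def v_def norm_eq_sqrt_inner inner_vec_def sum_2)
  then have "is_cap_apex (2 * \<epsilon>) u v q \<longleftrightarrow> q = midpoint u v + (2 * \<epsilon>) *\<^sub>R rot (v - u)
      \<or> q = midpoint u v - (2 * \<epsilon>) *\<^sub>R rot (v - u)" for q
    using assms by (intro is_cap_apex_iff[OF uv]) simp
  moreover have "(midpoint u v + (2 * \<epsilon>) *\<^sub>R rot (v - u)) $ 2 > 0"
    "\<not> (midpoint u v - (2 * \<epsilon>) *\<^sub>R rot (v - u)) $ 2 > 0"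
    using assms by (simp_all add: u_def v_def midpoint_def rot_def)
  ultimately have "(THE q. is_cap_apex (2 * \<epsilon>) u v q \<and> q $ 2 > 0) = midpoint u v + (2 * \<epsilon>) *\<^sub>R rot (v - u)"
    by (intro the_equality) auto
  then show ?thesis by (simp add: u_def v_def slope_def Let_def)
qed

text \<open>One induction serves all three claims: the apex at level \<open>Suc n\<close> is
  identified from the length and slope at level \<open>n\<close>, and containment in the parent is
  part of what defines that apex.\<close>

lemma cap_data_shape:
  assumes "0 < \<epsilon>" "\<epsilon> < 1 / 100" and "cap_data \<epsilon> n i = (a, p, b)"
  shows "norm (b - a) = stretch \<epsilon> n / 2 ^ n"
    and "p = midpoint a b + slope \<epsilon> n *\<^sub>R rot (b - a)"
    and "n = Suc m \<Longrightarrow> cap \<epsilon> n i \<subseteq> cap \<epsilon> m ((i + 1) div 2)"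
proof -
  have "norm (b - a) = stretch \<epsilon> n / 2 ^ n \<and> p = midpoint a b + slope \<epsilon> n *\<^sub>R rot (b - a)
    \<and> (\<forall>m. n = Suc m \<longrightarrow> cap \<epsilon> n i \<subseteq> cap \<epsilon> m ((i + 1) div 2))"
    using assms(3)
  proof (induction n arbitrary: i a p b)
    case 0
    have "norm (vector [1, 0] - vector [0, 0] :: plane) = 1"
      by (simp add: norm_eq_sqrt_inner inner_vec_def sum_2)
    then show ?case using 0[unfolded cap_data_0[OF assms(1)]] by auto
  next
    case (Suc n)
    obtain a' p' b' where data: "cap_data \<epsilon> n ((i + 1) div 2) = (a', p', b')"
      by (cases "cap_data \<epsilon> n ((i + 1) div 2)")
    note IH = Suc.IH[OF data]
    define u v where "u = (if odd i then a' else p')" and "v = (if odd i then p' else b')"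
    have uv: "(u, v) = (a', p') \<or> (u, v) = (p', b')" by (auto simp: u_def v_def)
    have ab: "a = u" "b = v"
      and p: "p = (THE q. is_cap_apex (2 / 2 ^ Suc n * \<epsilon>) u v q \<and>
                 convex hull {u, v, q} \<subseteq> convex hull {a', b', p'})"
      using Suc.prems data by (auto simp: u_def v_def)
    define d where "d = b' - a'"
    have "norm (v - u) = sqrt (1 + 4 * (slope \<epsilon> n)\<^sup>2) * norm d / 2"
      using uv
    proof
      assume "(u, v) = (a', p')"
      then have "v - u = (1 / 2) *\<^sub>R d + slope \<epsilon> n *\<^sub>R rot d"
        using IH by (simp add: midpoint_eq_add d_def)
      then show ?thesis by (simp only: norm_lateral_edge)
    next
      assume "(u, v) = (p', b')"
      then have "v - u = (1 / 2) *\<^sub>R d + (- slope \<epsilon> n) *\<^sub>R rot d"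
        using IH midpoint_eq_add[of b' a']
        by (simp add: d_def midpoint_sym[of a' b'] algebra_simps)
      then show ?thesis by (simp only: norm_lateral_edge power2_minus)
    qed
    then have len: "norm (v - u) = stretch \<epsilon> (Suc n) / 2 ^ Suc n"
      using IH by (simp add: stretch_Suc d_def)
    have neq: "a' \<noteq> b'" using IH stretch_pos[of \<epsilon> n] by auto
    \<comment> \<open>The prescribed height divided by the length of the new segment is the absolute
      slope.\<close>
    have h: "2 / 2 ^ Suc n * \<epsilon> = \<bar>slope \<epsilon> (Suc n)\<bar> * norm (v - u)"
      unfolding slope_props(1)[OF assms(1,2)] len using stretch_pos[of \<epsilon> "Suc n"] by simp
    have sl: "\<bar>slope \<epsilon> n\<bar> \<le> 1 / 2" using slope_props(2)[OF assms(1,2), of n] by simp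
    note the = the_inner_cap_apex[OF _ neq slope_props(4,3)[OF assms(1,2)] sl uv h]
    have p_eq: "p = midpoint u v + slope \<epsilon> (Suc n) *\<^sub>R rot (v - u)"
      unfolding p using IH by (intro the(1)) auto
    have "cap \<epsilon> (Suc n) i \<subseteq> cap \<epsilon> n ((i + 1) div 2)"
      unfolding cap_def Suc.prems data using the(2) IH by (simp add: ab p_eq)
    then show ?case using len p_eq by (simp add: ab)
  qed
  then show "norm (b - a) = stretch \<epsilon> n / 2 ^ n"
    and "p = midpoint a b + slope \<epsilon> n *\<^sub>R rot (b - a)"
    and "n = Suc m \<Longrightarrow> cap \<epsilon> n i \<subseteq> cap \<epsilon> m ((i + 1) div 2)"
    by auto
qed

section \<open>The limit curve\<close>

text \<open>Number of the dyadic interval of length \<open>1 / 2 ^ n\<close>, closed on the left and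
  open on the right, that contains \<open>t\<close>; counted from 1 like the segments.\<close>

definition address :: "nat \<Rightarrow> real \<Rightarrow> nat" where
  "address n t = nat \<lfloor>2 ^ n * t\<rfloor> + 1"

lemma address_le: "0 \<le> t \<Longrightarrow> real (address n t) \<le> 2 ^ n * t + 1"
  and address_gt: "0 \<le> t \<Longrightarrow> 2 ^ n * t < real (address n t)"
  unfolding address_def by (simp_all, linarith+)

text \<open>Dropping the last binary digit of \<open>t\<close> is passing to the parent in the
  indexing of \<open>cap_data\<close>.\<close>

lemma address_Suc:
  assumes "0 \<le> t"
  shows "(address (Suc n) t + 1) div 2 = address n t"
proof -
  have "\<lfloor>2 ^ n * t\<rfloor> = \<lfloor>(2 ^ Suc n * t) / real_of_int 2\<rfloor>" by simp
  also have "\<dots> = \<lfloor>2 ^ Suc n * t\<rfloor> div 2" by (rule floor_divide_real_eq_div) simp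
  finally show ?thesis
    using assms by (simp add: address_def nat_div_distrib)
qed

lemma address_mem:
  assumes "0 \<le> t" "t < 1"
  shows "address n t \<in> {1..2 ^ n}"
proof -
  have "2 ^ n * t < 2 ^ n" using assms by simp
  then have "real (address n t) < 2 ^ n + 1" using address_le[of t n] assms by linarith
  then have "real (address n t) < real (2 ^ n + 1)" by simp
  then have "address n t < 2 ^ n + 1" by (simp only: of_nat_less_iff)
  moreover have "1 \<le> address n t" by (simp add: address_def)
  ultimately show ?thesis by simp
qed

definition limit_point :: "real \<Rightarrow> real \<Rightarrow> plane" where
  "limit_point \<epsilon> t = (SOME x. \<forall>n. x \<in> cap \<epsilon> n (address n t))"

text \<open>The caps along an address are nonempty, compact and decreasing, so they have a common
  point.\<close>

lemma limit_point_mem: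
  assumes "0 < \<epsilon>" "\<epsilon> < 1 / 100" and t: "0 \<le> t"
  shows "limit_point \<epsilon> t \<in> cap \<epsilon> n (address n t)"
proof -
  define C where "C n = cap \<epsilon> n (address n t)" for n
  have sub: "C (Suc n) \<subseteq> C n" for n
  proof -
    obtain a p b where "cap_data \<epsilon> (Suc n) (address (Suc n) t) = (a, p, b)"
      by (rule prod_cases3)
    then show ?thesis
      unfolding C_def using cap_data_shape(3)[OF assms(1,2) _ refl] address_Suc[OF t, of n] by metis
  qed
  have "\<Inter> (range C) \<noteq> {}"
  proof (rule compact_nest)
    show "compact (C n)" "C n \<noteq> {}" for n
      by (auto simp: C_def cap_def split: prod.split intro!: finite_imp_compact_convex_hull)
    show "m \<le> n \<Longrightarrow> C n \<subseteq> C m" for m n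
      using sub by (rule lift_Suc_antimono_le)
  qed
  then have "\<exists>x. \<forall>n. x \<in> cap \<epsilon> n (address n t)" by (auto simp: C_def)
  then show ?thesis unfolding limit_point_def by (rule someI2_ex) blast
qed

section \<open>Lower bounds for distances on the limit curve\<close>

lemma inverse_power_2_less:
  fixes x :: real
  assumes "0 < x"
  obtains n where "1 / 2 ^ n < x"
  using real_arch_pow_inv[of x "1 / 2"] assms by (auto simp: power_divide)

lemma power_2_exponent_le:
  assumes "1 / 2 ^ Suc n < (1 / 2 ^ M :: real)"
  shows "M \<le> n"
proof -
  have "(2::real) ^ M < 2 ^ Suc n" using assms by (simp add: field_simps del: power_Suc)
  then have "M < Suc n" by (simp only: power_strict_increasing_iff)
  then show ?thesis by simp
qed

text \<open>\<open>w\<close> is the parameter distance from \<open>t\<close> to the right end of its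
  dyadic interval. While \<open>t\<close> lies in the right half, passing to the child changes
  neither \<open>b\<close> nor \<open>w\<close>. At the first level \<open>n\<close> where
  \<open>t\<close> lies in the left half, \<open>b\<close> is at least half a base away from the
  limit point, while \<open>w\<close> is at most \<open>1 / 2 ^ n\<close>.\<close>

lemma limit_point_far_from_end:
  assumes e: "0 < \<epsilon>" "\<epsilon> < 1 / 100" and t: "0 \<le> t"
    and data: "cap_data \<epsilon> n (address n t) = (a, p, b)"
    and w: "w = real (address n t) / 2 ^ n - t" "w < 1 / 2 ^ M"
  shows "w * stretch \<epsilon> M / 2 \<le> norm (b - limit_point \<epsilon> t)"
proof -
  have "t < real (address n t) / 2 ^ n" using address_gt[OF t, of n] by (simp add: field_simps)
  then have "0 < w" using w(1) by simp
  \<comment> \<open>Since \<open>w \<le> 1 / 2 ^ n\<close> at every level visited, the descent stops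
    before level \<open>N\<close>.\<close>
  then obtain N where N: "1 / 2 ^ N < w" by (rule inverse_power_2_less)
  show ?thesis using data w(1)
  proof (induction "N - n" arbitrary: n a p rule: less_induct)
    case less
    have w_le: "w \<le> 1 / 2 ^ n" using address_le[OF t, of n] less.prems(2) by (simp add: field_simps)
    then have "1 / 2 ^ N < (1 / 2 ^ n :: real)" using N by simp
    then have "(2::real) ^ n < 2 ^ N" by (simp add: field_simps)
    then have nN: "n < N" by simp
    define k where "k = address (Suc n) t"
    have k: "(k + 1) div 2 = address n t" unfolding k_def by (rule address_Suc[OF t])
    note shape = cap_data_shape[OF e less.prems(1)]
    obtain u q v where data': "cap_data \<epsilon> (Suc n) k = (u, q, v)" by (rule prod_cases3)
    note shape' = cap_data_shape[OF e data']
    show ?case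
    proof (cases "odd k")
      case False
      then have v: "v = b" and k2: "k = 2 * address n t"
        using data' k less.prems(1) by auto
      have "w = real k / 2 ^ Suc n - t" using less.prems(2) by (simp add: k2)
      then show ?thesis using less.hyps[of "Suc n" u q] nN data' by (simp add: v k_def)
    next
      case True
      then have uv: "u = a" "v = p"
        using data' k less.prems(1) by auto
      have k2: "k + 1 = 2 * address n t" using True k by presburger
      have "real k + 1 = 2 * real (address n t)" using k2 by linarith
      \<comment> \<open>In the left half \<open>w\<close> exceeds half the interval. With
        \<open>w < 1 / 2 ^ M\<close> this forces \<open>M \<le> n\<close>, so \<open>stretch\<close>
        at level \<open>n\<close> dominates that at level \<open>M\<close>.\<close>
      then have "1 / 2 ^ Suc n < w"
        using address_gt[OF t, of "Suc n"] less.prems(2) by (simp add: field_simps flip: k_def)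
      then have "1 / 2 ^ Suc n < (1 / 2 ^ M :: real)" using w(2) by simp
      then have Mn: "M \<le> n" by (rule power_2_exponent_le)
      have "limit_point \<epsilon> t \<in> convex hull {a, p, q}"
        using limit_point_mem[OF e t, of "Suc n"] data' by (simp add: cap_def uv flip: k_def)
      then have "norm (b - a) / 2 \<le> norm (b - limit_point \<epsilon> t)"
        using shape(2) shape'(2) slope_props(2)[OF e] by (intro child_cap_cone(2)) (auto simp: uv)
      moreover have "w * stretch \<epsilon> M \<le> 1 / 2 ^ n * stretch \<epsilon> n"
        using w_le Mn stretch_pos[of \<epsilon> M] by (intro mult_mono stretch_mono) auto
      ultimately show ?thesis using shape(1) by simp
    qed
  qed
qed

text \<open>Mirror image of the estimate at the right end. Dyadic intervals contain their left end,
  so \<open>w = 0\<close> can occur; it is split off because the descent would not terminate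
  there.\<close>

lemma limit_point_far_from_start:
  assumes e: "0 < \<epsilon>" "\<epsilon> < 1 / 100" and t: "0 \<le> t"
    and data: "cap_data \<epsilon> n (address n t) = (a, p, b)"
    and w: "w = t - (real (address n t) - 1) / 2 ^ n" "w < 1 / 2 ^ M"
  shows "w * stretch \<epsilon> M / 2 \<le> norm (a - limit_point \<epsilon> t)"
proof (cases "w = 0")
  case True
  then show ?thesis by simp
next
  case False
  have "(real (address n t) - 1) / 2 ^ n \<le> t" using address_le[OF t, of n] by (simp add: field_simps)
  then have "0 \<le> w" using w(1) by simp
  then obtain N where N: "1 / 2 ^ N < w" using False inverse_power_2_less[of w] by auto
  show ?thesis using data w(1)
  proof (induction "N - n" arbitrary: n b p rule: less_induct)
    case less
    have w_le: "w < 1 / 2 ^ n" using address_gt[OF t, of n] less.prems(2) by (simp add: field_simps)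
    then have "1 / 2 ^ N < (1 / 2 ^ n :: real)" using N by simp
    then have "(2::real) ^ n < 2 ^ N" by (simp add: field_simps)
    then have nN: "n < N" by simp
    define k where "k = address (Suc n) t"
    have k: "(k + 1) div 2 = address n t" unfolding k_def by (rule address_Suc[OF t])
    note shape = cap_data_shape[OF e less.prems(1)]
    obtain u q v where data': "cap_data \<epsilon> (Suc n) k = (u, q, v)" by (rule prod_cases3)
    note shape' = cap_data_shape[OF e data']
    show ?case
    proof (cases "odd k")
      case True
      then have u: "u = a"
        using data' k less.prems(1) by auto
      have k2: "k + 1 = 2 * address n t" using True k by presburger
      have "real k + 1 = 2 * real (address n t)" using k2 by linarith
      then have "w = t - (real k - 1) / 2 ^ Suc n" using less.prems(2) by (simp add: field_simps)
      then show ?thesis using less.hyps[of "Suc n" q v] nN data' by (simp add: u k_def)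
    next
      case False
      then have uv: "u = p" "v = b" and k2: "k = 2 * address n t"
        using data' k less.prems(1) by auto
      have "1 / 2 ^ Suc n \<le> w"
        using address_le[OF t, of "Suc n"] less.prems(2) k2 by (simp add: field_simps flip: k_def)
      then have "1 / 2 ^ Suc n < (1 / 2 ^ M :: real)" using w(2) by simp
      then have Mn: "M \<le> n" by (rule power_2_exponent_le)
      have "limit_point \<epsilon> t \<in> convex hull {b, p, q}"
        using limit_point_mem[OF e t, of "Suc n"] data'
        by (simp add: cap_def uv insert_commute flip: k_def)
      \<comment> \<open>Parent and second child are both read from right to left here.\<close>
      then have "norm (a - b) / 2 \<le> norm (a - limit_point \<epsilon> t)"
        using slope_props(2)[OF e]
        by (intro child_cap_cone(2)[OF shape(2)[unfolded apex_reverse[of a]]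
              shape'(2)[unfolded uv apex_reverse[of p]]]) simp_all
      moreover have "w * stretch \<epsilon> M \<le> 1 / 2 ^ n * stretch \<epsilon> n"
        using w_le Mn stretch_pos[of \<epsilon> M] by (intro mult_mono stretch_mono) auto
      ultimately show ?thesis using shape(1) by (simp add: norm_minus_commute)
    qed
  qed
qed

text \<open>In the last common cap \<open>s\<close> goes to the first child and \<open>t\<close> to
  the second. By the cones at the shared apex \<open>p\<close>, the distance of the two points is at
  least \<open>9 / 10\<close> of the sum of their distances to \<open>p\<close>. Each of these is at
  least \<open>stretch / 2\<close> times its parameter gap, whence \<open>9 / 20\<close>.\<close>

lemma limit_point_expanding_less:
  assumes e: "0 < \<epsilon>" "\<epsilon> < 1 / 100" and st: "0 \<le> s" "s < t" "t < 1" "t - s < 1 / 2 ^ M"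
  shows "9 / 20 * stretch \<epsilon> M * (t - s) \<le> norm (limit_point \<epsilon> t - limit_point \<epsilon> s)"
proof -
  have t: "0 \<le> t" using st by simp
  obtain N where "1 / 2 ^ N < t - s" using inverse_power_2_less[of "t - s"] st by auto
  then have "2 ^ N * s + 1 < 2 ^ N * t" by (simp add: field_simps)
  then have "address N s \<noteq> address N t"
    using address_le[OF st(1), of N] address_gt[OF t, of N] by linarith
  moreover have "address 0 s = address 0 t"
    using address_mem[of s 0] address_mem[of t 0] st by auto
  \<comment> \<open>The addresses agree at level \<open>0\<close> and differ at level
    \<open>N\<close>, so there is a first level \<open>Suc n\<close> of disagreement.\<close>
  ultimately obtain n where eq: "address n s = address n t"
    and neq: "address (Suc n) s \<noteq> address (Suc n) t"
    using ex_least_nat_less[of "\<lambda>n. address n s \<noteq> address n t" N] by blast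
  define k where "k = address n s"
  have "address (Suc n) s \<le> address (Suc n) t"
    unfolding address_def using st by (intro add_right_mono nat_mono floor_mono) simp
  moreover have "1 \<le> k" by (simp add: k_def address_def)
  ultimately have ks: "address (Suc n) s = 2 * k - 1" and kt: "address (Suc n) t = 2 * k" and k1: "1 \<le> k"
    using neq address_Suc[OF st(1), of n] address_Suc[OF t, of n] eq unfolding k_def by linarith+
  obtain a p b where data: "cap_data \<epsilon> n k = (a, p, b)" by (rule prod_cases3)
  have odd: "odd (2 * k - 1)" "(2 * k - 1 + 1) div 2 = k" using k1 by auto
  obtain q where datas: "cap_data \<epsilon> (Suc n) (address (Suc n) s) = (a, q, p)"
    unfolding ks using odd data by simp
  obtain r where datat: "cap_data \<epsilon> (Suc n) (address (Suc n) t) = (p, r, b)"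
    unfolding kt using data by simp
  note shape = cap_data_shape[OF e data]
  define x y where "x = limit_point \<epsilon> s" and "y = limit_point \<epsilon> t"
  \<comment> \<open>The parameter of the apex \<open>p\<close>: the midpoint of the dyadic interval
    of the common cap.\<close>
  define m where "m = (2 * real k - 1) / 2 ^ Suc n"
  have rk: "real (2 * k - 1) = 2 * real k - 1" using k1 by (simp add: of_nat_diff)
  have sm: "s < m" using address_gt[OF st(1), of "Suc n"] unfolding ks rk m_def by (simp add: field_simps)
  have mt: "m \<le> t" using address_le[OF t, of "Suc n"] unfolding kt m_def by (simp add: field_simps)
  have 1: "(m - s) * stretch \<epsilon> M / 2 \<le> norm (p - x)"
    unfolding x_def using sm mt st(4)
    by (intro limit_point_far_from_end[OF e st(1) datas]) (auto simp only: ks rk m_def)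
  have 2: "(t - m) * stretch \<epsilon> M / 2 \<le> norm (p - y)"
    unfolding y_def using sm mt st(4)
    by (intro limit_point_far_from_start[OF e t datat]) (auto simp only: kt m_def of_nat_mult of_nat_numeral)
  have "x \<in> convex hull {a, p, q}"
    using limit_point_mem[OF e st(1), of "Suc n"] datas by (simp add: cap_def x_def)
  then have 3: "9 / 10 * norm (p - x) * norm (b - a) \<le> (p - x) \<bullet> (b - a)"
    using shape(2) cap_data_shape(2)[OF e datas] slope_props(2)[OF e] by (intro child_cap_cone(1)) auto
  have "y \<in> convex hull {b, p, r}"
    using limit_point_mem[OF e t, of "Suc n"] datat by (simp add: cap_def y_def insert_commute)
  then have 4: "9 / 10 * norm (p - y) * norm (a - b) \<le> (p - y) \<bullet> (a - b)"
    using slope_props(2)[OF e]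
    by (intro child_cap_cone(1)[OF shape(2)[unfolded apex_reverse[of a]]
          cap_data_shape(2)[OF e datat, unfolded apex_reverse[of p]]]) simp_all
  have "9 / 10 * (norm (p - x) + norm (p - y)) * norm (b - a) \<le> (y - x) \<bullet> (b - a)"
  proof -
    have "(y - x) \<bullet> (b - a) = (p - x) \<bullet> (b - a) + (p - y) \<bullet> (a - b)"
      by (simp add: inner_diff_left inner_diff_right)
    moreover have "9 / 10 * (norm (p - x) + norm (p - y)) * norm (b - a)
        = 9 / 10 * norm (p - x) * norm (b - a) + 9 / 10 * norm (p - y) * norm (a - b)"
      by (simp add: norm_minus_commute[of a] algebra_simps add_divide_distrib)
    ultimately show ?thesis using 3 4 by linarith
  qed
  also have "\<dots> \<le> norm (y - x) * norm (b - a)" by (rule norm_cauchy_schwarz)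
  finally have 5: "9 / 10 * (norm (p - x) + norm (p - y)) \<le> norm (y - x)"
    by (rule mult_right_le_imp_le) (simp add: shape(1) stretch_pos)
  have "9 / 20 * stretch \<epsilon> M * (t - s)
      = 9 / 10 * ((m - s) * stretch \<epsilon> M / 2 + (t - m) * stretch \<epsilon> M / 2)"
    by (simp add: field_simps)
  also have "\<dots> \<le> 9 / 10 * (norm (p - x) + norm (p - y))"
    using 1 2 by (intro mult_left_mono add_mono) auto
  also note 5
  finally show ?thesis by (simp only: x_def y_def)
qed

lemma limit_point_expanding:
  assumes "0 < \<epsilon>" "\<epsilon> < 1 / 100" and "s \<in> {0..<1}" "t \<in> {0..<1}" "\<bar>s - t\<bar> < 1 / 2 ^ M"
  shows "9 / 20 * stretch \<epsilon> M * \<bar>s - t\<bar> \<le> dist (limit_point \<epsilon> s) (limit_point \<epsilon> t)"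
  using limit_point_expanding_less[OF assms(1,2), of s t M] limit_point_expanding_less[OF assms(1,2), of t s M]
    assms(3-5)
  by (cases s t rule: linorder_cases) (auto simp: dist_norm norm_minus_commute)

text \<open>For \<open>M = 0\<close> the value of \<open>stretch\<close> is 1 and any two parameters
  are close enough.\<close>

lemma limit_point_expanding_global:
  assumes "0 < \<epsilon>" "\<epsilon> < 1 / 100" and "s \<in> {0..<1}" "t \<in> {0..<1}"
  shows "9 / 20 * \<bar>s - t\<bar> \<le> dist (limit_point \<epsilon> s) (limit_point \<epsilon> t)"
  using limit_point_expanding[OF assms, of 0] assms(3,4) by auto

section \<open>Hausdorff measure and expanding maps\<close>

lemma hausdorff1_closed_segment_finite:
  fixes a b :: "'a::real_normed_vector"
  shows "hausdorff1 (closed_segment a b) < \<infinity>"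
proof -
  have "hausdorff1_pre \<delta> (closed_segment a b) \<le> ennreal (2 * norm (b - a))" if "0 < \<delta>" for \<delta>
  proof -
    obtain N where N: "norm (b - a) / \<delta> < real N" using reals_Archimedean2 by blast
    moreover have "0 \<le> norm (b - a) / \<delta>" using that by simp
    ultimately have N0: "0 < real N" by linarith
    \<comment> \<open>Index \<open>N\<close> is included because the floor of \<open>u * N\<close>
      is \<open>N\<close> at \<open>u = 1\<close>. The empty sets beyond it have diameter 0.\<close>
    define C where "C k = (if k \<le> N then (\<lambda>u. a + u *\<^sub>R (b - a)) ` {real k / N..(real k + 1) / N} else {})" for k
    have dist_le: "norm (x - y) \<le> norm (b - a) / N" if "x \<in> C k" "y \<in> C k" for x y k
    proof -
      from that obtain u v where uv: "x = a + u *\<^sub>R (b - a)" "y = a + v *\<^sub>R (b - a)"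
        "u \<in> {real k / N..(real k + 1) / N}" "v \<in> {real k / N..(real k + 1) / N}"
        unfolding C_def by (smt (verit, best) empty_iff imageE)
      have "\<bar>u - v\<bar> \<le> (real k + 1) / N - real k / N" using uv by auto
      also have "\<dots> = 1 / N" by (simp add: diff_divide_distrib[symmetric])
      finally have "\<bar>u - v\<bar> * norm (b - a) \<le> 1 / N * norm (b - a)" by (rule mult_right_mono) simp
      moreover have "x - y = (u - v) *\<^sub>R (b - a)" by (simp add: uv algebra_simps)
      ultimately show ?thesis by simp
    qed
    have diam: "diameter (C k) \<le> norm (b - a) / N" for k
      using dist_le by (intro diameter_le) auto
    have "norm (b - a) / N \<le> \<delta>" using N N0 that by (simp add: field_simps)
    then have diam_\<delta>: "diameter (C k) \<le> \<delta>" for k using diam[of k] by linarith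
    have bdd: "bounded (C k)" for k
      by (simp add: C_def compact_continuous_image compact_imp_bounded continuous_intros)
    have "closed_segment a b \<subseteq> (\<Union>k. C k)"
    proof
      fix x assume "x \<in> closed_segment a b"
      then obtain u where u: "x = a + u *\<^sub>R (b - a)" "0 \<le> u" "u \<le> 1"
        by (auto simp: in_segment algebra_simps)
      define k where "k = nat \<lfloor>u * N\<rfloor>"
      have k: "real k \<le> u * N" "u * N \<le> real k + 1" using u N0 by (auto simp: k_def)
      have "u * N \<le> 1 * real N" using u N0 by (intro mult_right_mono) auto
      then have "k \<le> N" using k by linarith
      moreover have "u \<in> {real k / N..(real k + 1) / N}" using k N0 by (auto simp: field_simps)
      ultimately have "x \<in> C k" using u by (auto simp: C_def)
      then show "x \<in> (\<Union>k. C k)" by blast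
    qed
    then have "hausdorff1_pre \<delta> (closed_segment a b) \<le> (\<Sum>k. ennreal (diameter (C k)))"
      unfolding hausdorff1_pre_def using bdd diam_\<delta> by (intro INF_lower) auto
    also have "\<dots> = (\<Sum>k\<le>N. ennreal (diameter (C k)))"
      by (intro suminf_finite) (auto simp: C_def)
    also have "\<dots> \<le> (\<Sum>k\<le>N. ennreal (norm (b - a) / N))"
      by (intro sum_mono ennreal_leI diam)
    also have "\<dots> = ennreal ((real N + 1) * (norm (b - a) / N))"
      by (subst sum_ennreal) (simp_all add: algebra_simps)
    also have "\<dots> \<le> ennreal (2 * norm (b - a))"
    proof (intro ennreal_leI)
      have "1 \<le> real N" using N0 by simp
      then have "(real N + 1) * norm (b - a) \<le> (2 * N) * norm (b - a)"
        by (intro mult_right_mono) auto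
      then show "(real N + 1) * (norm (b - a) / N) \<le> 2 * norm (b - a)"
        using N0 by (simp add: field_simps)
    qed
    finally show ?thesis .
  qed
  then have "hausdorff1 (closed_segment a b) \<le> ennreal (2 * norm (b - a))"
    unfolding hausdorff1_def by (intro SUP_least) auto
  then show ?thesis by (rule order.strict_trans1) simp
qed

text \<open>Supplies measurable supersets for preimages whose measurability is not established. An
  interval centred at a point of \<open>A\<close> works, at the cost of a factor 2.\<close>

lemma small_set_cover:
  fixes A :: "real set"
  assumes "\<And>s t. s \<in> A \<Longrightarrow> t \<in> A \<Longrightarrow> \<bar>s - t\<bar> \<le> r"
  shows "\<exists>T \<in> sets lebesgue. A \<subseteq> T \<and> emeasure lebesgue T \<le> ennreal (2 * r)"
proof (cases "A = {}")
  case True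
  then show ?thesis by (intro bexI[of _ "{}"]) auto
next
  case False
  then obtain t where t: "t \<in> A" by blast
  then have "0 \<le> r" using assms[OF t t] by simp
  moreover have "A \<subseteq> {t - r..t + r}" using assms[OF t] by fastforce
  ultimately show ?thesis by (intro bexI[of _ "{t - r..t + r}"]) auto
qed

text \<open>The mass distribution principle, with the Lebesgue measure of the parameter domain as mass.\<close>

lemma negligible_expanding_preimage:
  fixes f :: "real \<Rightarrow> 'a::metric_space"
  assumes "0 < c" and global: "\<And>s t. s \<in> S \<Longrightarrow> t \<in> S \<Longrightarrow> c * \<bar>s - t\<bar> \<le> dist (f s) (f t)"
    and "local": "\<And>K. \<exists>d>0. \<forall>s\<in>S. \<forall>t\<in>S. \<bar>s - t\<bar> < d \<longrightarrow> K * \<bar>s - t\<bar> \<le> dist (f s) (f t)"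
    and fin: "hausdorff1 E < \<infinity>"
  shows "negligible {t \<in> S. f t \<in> E}"
  unfolding negligible_outer
proof (intro allI impI)
  fix e :: real assume e: "0 < e"
  obtain h where h: "0 \<le> h" "hausdorff1 E = ennreal h"
    using fin by (cases "hausdorff1 E") auto
  \<comment> \<open>Chosen so that \<open>2 / K * (h + 1)\<close> equals
    \<open>e / 2\<close>.\<close>
  define K where "K = 4 * (h + 1) / e"
  have K: "0 < K" using h e by (simp add: K_def)
  obtain d where d: "0 < d"
    "\<And>s t. s \<in> S \<Longrightarrow> t \<in> S \<Longrightarrow> \<bar>s - t\<bar> < d \<Longrightarrow> K * \<bar>s - t\<bar> \<le> dist (f s) (f t)"
    using "local"[of K] by blast
  \<comment> \<open>By the global bound, parameters mapped into one cover set of diameter at most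
    \<open>\<delta>\<close> are at most \<open>d / 2\<close> apart, so the local bound with factor
    \<open>K\<close> applies to them.\<close>
  define \<delta> where "\<delta> = c * d / 2"
  have "hausdorff1_pre \<delta> E \<le> hausdorff1 E"
    unfolding hausdorff1_def using d \<open>0 < c\<close> by (intro SUP_upper) (simp add: \<delta>_def)
  also have "\<dots> < ennreal (h + 1)" using h by (simp add: ennreal_less_iff)
  finally obtain C where C: "E \<subseteq> (\<Union>k. C k)" "\<And>k. bounded (C k)" "\<And>k. diameter (C k) \<le> \<delta>"
      and sum: "(\<Sum>k. ennreal (diameter (C k))) < ennreal (h + 1)"
    unfolding hausdorff1_pre_def INF_less_iff by auto
  define A where "A k = {t \<in> S. f t \<in> C k}" for k
  have "\<exists>T \<in> sets lebesgue. A k \<subseteq> T \<and> emeasure lebesgue T \<le> ennreal (2 * (diameter (C k) / K))" for k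
  proof (rule small_set_cover)
    fix s t assume st: "s \<in> A k" "t \<in> A k"
    then have le: "dist (f s) (f t) \<le> diameter (C k)"
      using diameter_bounded_bound[OF C(2)[of k]] by (simp add: A_def)
    have S: "s \<in> S" "t \<in> S" using st by (auto simp: A_def)
    have "c * \<bar>s - t\<bar> \<le> c * (d / 2)" using global[OF S] le C(3)[of k] by (simp add: \<delta>_def)
    then have "\<bar>s - t\<bar> \<le> d / 2" using \<open>0 < c\<close> by simp
    then have "\<bar>s - t\<bar> < d" using d(1) by linarith
    then have "K * \<bar>s - t\<bar> \<le> diameter (C k)" using d(2)[OF S] le by simp
    then show "\<bar>s - t\<bar> \<le> diameter (C k) / K" using K by (simp add: field_simps)
  qed
  then obtain T where T: "\<And>k. T k \<in> sets lebesgue" "\<And>k. A k \<subseteq> T k"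
    "\<And>k. emeasure lebesgue (T k) \<le> ennreal (2 * (diameter (C k) / K))"
    by metis
  have "emeasure lebesgue (\<Union>k. T k) \<le> (\<Sum>k. emeasure lebesgue (T k))"
    using T by (intro emeasure_subadditive_countably) auto
  also have "\<dots> \<le> (\<Sum>k. ennreal (2 / K) * ennreal (diameter (C k)))"
    using T(3) K diameter_ge_0[OF C(2)] by (intro suminf_le) (auto simp flip: ennreal_mult)
  also have "\<dots> = ennreal (2 / K) * (\<Sum>k. ennreal (diameter (C k)))" by simp
  also have "\<dots> \<le> ennreal (2 / K) * ennreal (h + 1)" using sum by (intro mult_left_mono) auto
  also have "\<dots> = ennreal (e / 2)"
  proof -
    have "2 / K * (h + 1) = e / 2" using h e by (simp add: K_def field_simps)
    then show ?thesis
      using K h by (metis ennreal_mult less_eq_real_def divide_nonneg_pos zero_le_numeral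
          add_nonneg_nonneg zero_le_one)
  qed
  finally have em: "emeasure lebesgue (\<Union>k. T k) \<le> ennreal (e / 2)" .
  show "\<exists>T. {t \<in> S. f t \<in> E} \<subseteq> T \<and> T \<in> lmeasurable \<and> measure lebesgue T < e"
  proof (intro exI conjI)
    show "{t \<in> S. f t \<in> E} \<subseteq> (\<Union>k. T k)" using C(1) T(2) by (fastforce simp: A_def)
    show "(\<Union>k. T k) \<in> lmeasurable"
      using T(1) em by (intro fmeasurableI) (auto simp: order.strict_trans1)
    have "measure lebesgue (\<Union>k. T k) \<le> e / 2"
      unfolding measure_def using em e by (intro enn2real_leI) auto
    then show "measure lebesgue (\<Union>k. T k) < e" using e by simp
  qed
qed

text \<open>Countably many of the balls from the definition cover \<open>E\<close>, and the part of
  \<open>E\<close> in each has a null preimage.\<close>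

lemma negligible_preimage_weak_locally_H1_finite:
  fixes f :: "real \<Rightarrow> 'a::{metric_space, second_countable_topology}"
  assumes neg: "\<And>E. hausdorff1 E < \<infinity> \<Longrightarrow> negligible {t \<in> S. f t \<in> E}"
    and E: "weak_locally_H1_finite E"
  shows "negligible {t \<in> S. f t \<in> E}"
proof -
  obtain \<rho> where \<rho>: "\<And>y. y \<in> E \<Longrightarrow> 0 < \<rho> y" "\<And>y. y \<in> E \<Longrightarrow> hausdorff1 (ball y (\<rho> y) \<inter> E) < \<infinity>"
    using E unfolding weak_locally_H1_finite_def by metis
  obtain \<F> where \<F>: "\<F> \<subseteq> (\<lambda>y. ball y (\<rho> y)) ` E" "countable \<F>" "\<Union> \<F> = (\<Union>y\<in>E. ball y (\<rho> y))"
    by (rule Lindelof[of "(\<lambda>y. ball y (\<rho> y)) ` E"]) auto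
  have "negligible {t \<in> S. f t \<in> B \<inter> E}" if "B \<in> \<F>" for B
    using that \<F>(1) \<rho>(2) by (intro neg) auto
  then have "negligible (\<Union>B\<in>\<F>. {t \<in> S. f t \<in> B \<inter> E})"
    using \<F>(2) by (intro negligible_countable_Union) auto
  moreover have "E \<subseteq> \<Union> \<F>" unfolding \<F>(3) using \<rho>(1) by fastforce
  ultimately show ?thesis by (elim negligible_subset) auto
qed

lemma hausdorff1_mono: "A \<subseteq> B \<Longrightarrow> hausdorff1 A \<le> hausdorff1 B"
  unfolding hausdorff1_def hausdorff1_pre_def
  by (intro SUP_subset_mono INF_superset_mono order_refl) auto

lemma weak_locally_H1_finite_subset:
  assumes "weak_locally_H1_finite B" and "A \<subseteq> B"
  shows "weak_locally_H1_finite A"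
  unfolding weak_locally_H1_finite_def
proof
  fix y assume "y \<in> A"
  then obtain \<rho> where \<rho>: "0 < \<rho>" "hausdorff1 (ball y \<rho> \<inter> B) < \<infinity>"
    using assms unfolding weak_locally_H1_finite_def by blast
  have "hausdorff1 (ball y \<rho> \<inter> A) \<le> hausdorff1 (ball y \<rho> \<inter> B)"
    using assms(2) by (intro hausdorff1_mono) auto
  then show "\<exists>\<rho>>0. hausdorff1 (ball y \<rho> \<inter> A) < \<infinity>" using \<rho> by (meson order.strict_trans1)
qed

section \<open>Preimages under the parametrisation\<close>

text \<open>A cap lies within one base length of its starting vertex, which is on the curve. Base
  lengths tend to 0 by the crude bound \<open>stretch \<epsilon> n \<le> 1 + real n\<close>.\<close>

lemma limit_point_in_closure:
  assumes e: "0 < \<epsilon>" "\<epsilon> < 1 / 100" and t: "0 \<le> t" "t < 1"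
  shows "limit_point \<epsilon> t \<in> closure (\<Union>n\<in>{1..}. curve \<epsilon> n)"
  unfolding closure_approachable
proof (intro allI impI)
  fix r :: real assume r: "0 < r"
  have "(\<lambda>n. real n / 2 ^ n) \<longlonglongrightarrow> 0" by (rule lim_n_over_pown) simp
  moreover have "(\<lambda>n. 1 / 2 ^ n :: real) \<longlonglongrightarrow> 0"
    using LIMSEQ_divide_realpow_zero[of 2 1] by simp
  ultimately have "(\<lambda>n. real n / 2 ^ n + 1 / 2 ^ n) \<longlonglongrightarrow> 0 + 0" by (rule tendsto_add)
  then have "\<forall>\<^sub>F n in sequentially. real n / 2 ^ n + 1 / 2 ^ n < r"
    using r by (intro order_tendstoD) auto
  then obtain N where N: "\<And>n. N \<le> n \<Longrightarrow> real n / 2 ^ n + 1 / 2 ^ n < r"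
    unfolding eventually_sequentially by blast
  \<comment> \<open>The successor keeps the level positive, as the union omits level 0.\<close>
  define n where "n = Suc N"
  obtain a p b where data: "cap_data \<epsilon> n (address n t) = (a, p, b)" by (rule prod_cases3)
  note shape = cap_data_shape[OF e data]
  have "16 * \<epsilon>\<^sup>2 \<le> 16 * (1 / 100)\<^sup>2" using e by (intro mult_left_mono power_mono) auto
  then have "real n * (16 * \<epsilon>\<^sup>2) \<le> real n * 1" by (intro mult_left_mono) (simp_all add: power2_eq_square)
  moreover have "1 + real n \<le> (1 + real n)\<^sup>2" by (simp add: power2_eq_square algebra_simps)
  ultimately have "1 + 16 * real n * \<epsilon>\<^sup>2 \<le> (1 + real n)\<^sup>2" by (simp add: mult_ac)
  then have "stretch \<epsilon> n \<le> 1 + real n" unfolding stretch_def by (intro real_le_lsqrt) auto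
  then have "norm (b - a) \<le> (1 + real n) / 2 ^ n" unfolding shape(1) by (rule divide_right_mono) simp
  also have "\<dots> < r" using N[of n] by (simp add: n_def add_divide_distrib)
  finally have ba: "norm (b - a) < r" .
  have "norm (p - a) \<le> norm ((1 / 2) *\<^sub>R (b - a)) + norm (slope \<epsilon> n *\<^sub>R rot (b - a))"
  proof -
    have "p - a = (1 / 2) *\<^sub>R (b - a) + slope \<epsilon> n *\<^sub>R rot (b - a)"
      unfolding shape(2) midpoint_eq_add by simp
    then show ?thesis by (metis norm_triangle_ineq)
  qed
  also have "\<dots> = (1 / 2 + \<bar>slope \<epsilon> n\<bar>) * norm (b - a)"
    by (simp add: norm_rot distrib_right del: scaleR_diff_right)
  also have "\<dots> \<le> 1 * norm (b - a)" using slope_props(2)[OF e, of n] by (intro mult_right_mono) auto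
  finally have "convex hull {a, b, p} \<subseteq> ball a r"
    using ba r by (intro hull_minimal) (auto simp: dist_norm norm_minus_commute)
  moreover have "limit_point \<epsilon> t \<in> convex hull {a, b, p}"
    using limit_point_mem[OF e t(1), of n] data by (simp add: cap_def)
  ultimately have "dist a (limit_point \<epsilon> t) < r" by auto
  moreover have "a \<in> (\<Union>n\<in>{1..}. curve \<epsilon> n)"
  proof (intro UN_I)
    show "n \<in> {1..}" by (simp add: n_def)
    have "a \<in> seg \<epsilon> n (address n t)" by (simp add: seg_def data)
    then show "a \<in> curve \<epsilon> n" unfolding curve_def using address_mem[OF t] by blast
  qed
  ultimately show "\<exists>y\<in>\<Union>n\<in>{1..}. curve \<epsilon> n. dist y (limit_point \<epsilon> t) < r" by blast
qed

lemma negligible_limit_point_preimage: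
  assumes e: "0 < \<epsilon>" "\<epsilon> < 1 / 100" and E: "hausdorff1 E < \<infinity>"
  shows "negligible {t \<in> {0..<1}. limit_point \<epsilon> t \<in> E}"
proof (rule negligible_expanding_preimage[where c = "9 / 20"])
  fix K :: real
  \<comment> \<open>The factor \<open>20 / 9\<close> cancels the \<open>9 / 20\<close> of the
    expansion bound.\<close>
  obtain M where M: "20 / 9 * K < stretch \<epsilon> M" using stretch_unbounded[OF e(1)] .
  show "\<exists>d>0. \<forall>s\<in>{0..<1}. \<forall>t\<in>{0..<1}. \<bar>s - t\<bar> < d \<longrightarrow>
    K * \<bar>s - t\<bar> \<le> dist (limit_point \<epsilon> s) (limit_point \<epsilon> t)"
  proof (intro exI[of _ "1 / 2 ^ M"] conjI ballI impI)
    fix s t :: real assume st: "s \<in> {0..<1}" "t \<in> {0..<1}" "\<bar>s - t\<bar> < 1 / 2 ^ M"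
    have "K * \<bar>s - t\<bar> \<le> 9 / 20 * stretch \<epsilon> M * \<bar>s - t\<bar>"
      using M by (intro mult_right_mono) auto
    also have "\<dots> \<le> dist (limit_point \<epsilon> s) (limit_point \<epsilon> t)"
      by (rule limit_point_expanding[OF e st])
    finally show "K * \<bar>s - t\<bar> \<le> dist (limit_point \<epsilon> s) (limit_point \<epsilon> t)" .
  qed simp
qed (use limit_point_expanding_global[OF e] E in auto)

section \<open>Size of the removed balls\<close>

lemma r_rad_le_rho: "r_rad \<epsilon> i \<le> rho \<epsilon> i"
  by (simp add: r_rad_def Let_def)

text \<open>The leading constant is \<open>1 / 512\<close>, and the square root is at most
  2.\<close>

lemma rho_Suc_le:
  assumes "0 < \<epsilon>" "\<epsilon> < 1 / 100"
  shows "rho \<epsilon> (Suc i) \<le> (1 / 4) ^ i / 256"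
proof -
  have "\<epsilon>\<^sup>2 \<le> (1 / 100)\<^sup>2" using assms by (intro power_mono) auto
  then have "sqrt (1 + 7 * 16 * \<epsilon>\<^sup>2) \<le> 2" by (intro real_le_lsqrt) (simp_all add: power2_eq_square)
  moreover have "rho \<epsilon> (Suc i) = (1 / 4) ^ i * (sqrt (1 + 7 * 16 * \<epsilon>\<^sup>2) / 512)"
    by (simp add: rho_def power_int_minus power_one_over inverse_eq_divide)
  ultimately show ?thesis by (simp add: field_simps)
qed

text \<open>Otherwise a null set and supersets of the preimages of the removed balls would cover the
  unit interval, although these supersets have total measure at most
  \<open>80 / 9 * (1 / 192)\<close>, that is \<open>5 / 108\<close>.\<close>

lemma not_negligible_calA_eps_preimage:
  assumes e: "0 < \<epsilon>" "\<epsilon> < 1 / 100"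
  shows "\<not> negligible {t \<in> {0..<1}. limit_point \<epsilon> t \<in> calA_eps \<epsilon>}"
proof
  define f where "f = limit_point \<epsilon>"
  assume neg: "negligible {t \<in> {0..<1}. limit_point \<epsilon> t \<in> calA_eps \<epsilon>}"
  \<comment> \<open>Outside \<open>Z\<close> a parameter gives a point of the closure that is on no
    curve and not in \<open>calA_eps \<epsilon>\<close>, hence lies in a removed ball.\<close>
  define Z where "Z = {t \<in> {0..<1}. f t \<in> calA_eps \<epsilon>} \<union> (\<Union>n i. {t \<in> {0..<1}. f t \<in> seg \<epsilon> n i})"
  have "negligible {t \<in> {0..<1}. f t \<in> seg \<epsilon> n i}" for n i
    unfolding f_def seg_def
    by (intro negligible_limit_point_preimage e) (simp split: prod.split add: hausdorff1_closed_segment_finite[simplified])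
  then have "negligible Z" unfolding Z_def using neg
    by (intro negligible_Un negligible_Union_nat) (simp_all add: f_def)
  then have Z: "Z \<in> null_sets lebesgue" by (simp add: negligible_iff_null_sets)
  define r where "r i = (1 / 4 :: real) ^ i / 256" for i
  define A where "A i = {t \<in> {0..<1}. f t \<in> ball (e_pt \<epsilon> (Suc i)) (r_rad \<epsilon> (Suc i))}" for i
  \<comment> \<open>Points of ball number \<open>Suc i\<close> are at most \<open>2 * r i\<close>
    apart. Dividing by \<open>9 / 20\<close> gives \<open>40 / 9 * r i\<close>, which the covering
    interval doubles.\<close>
  have "\<exists>T \<in> sets lebesgue. A i \<subseteq> T \<and> emeasure lebesgue T \<le> ennreal (2 * (40 / 9 * r i))" for i
  proof (rule small_set_cover)
    fix s t assume st: "s \<in> A i" "t \<in> A i"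
    have "9 / 20 * \<bar>s - t\<bar> \<le> dist (f s) (f t)"
      unfolding f_def using st by (intro limit_point_expanding_global[OF e]) (auto simp: A_def)
    also have "\<dots> \<le> dist (e_pt \<epsilon> (Suc i)) (f s) + dist (e_pt \<epsilon> (Suc i)) (f t)" by (rule dist_triangle3)
    also have "\<dots> \<le> 2 * r i"
      using st r_rad_le_rho[of \<epsilon> "Suc i"] rho_Suc_le[OF e, of i] by (auto simp: A_def r_def)
    finally show "\<bar>s - t\<bar> \<le> 40 / 9 * r i" by simp
  qed
  then obtain T where T: "\<And>i. T i \<in> sets lebesgue" "\<And>i. A i \<subseteq> T i"
    "\<And>i. emeasure lebesgue (T i) \<le> ennreal (2 * (40 / 9 * r i))"
    by metis
  have cover: "{0..<1} \<subseteq> Z \<union> (\<Union>i. T i)"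
  proof
    fix t :: real assume t: "t \<in> {0..<1}"
    show "t \<in> Z \<union> (\<Union>i. T i)"
    proof (cases "t \<in> Z")
      case False
      then have "f t \<notin> calA_eps \<epsilon>" and "f t \<notin> curve \<epsilon> n" for n
        using t by (auto simp: Z_def curve_def)
      moreover have "f t \<in> closure (\<Union>n\<in>{1..}. curve \<epsilon> n)"
        unfolding f_def using t by (intro limit_point_in_closure e) auto
      ultimately obtain i where i: "1 \<le> i" "f t \<in> ball (e_pt \<epsilon> i) (r_rad \<epsilon> i)"
        by (auto simp: calA_eps_def A_eps_def)
      then obtain j where "i = Suc j" by (cases i) auto
      then have "t \<in> A j" using i t by (simp add: A_def)
      then show ?thesis using T(2) by blast
    qed simp
  qed
  have sums: "r sums (1 / 192)"
  proof -
    have "(\<lambda>i. (1 / 4 :: real) ^ i) sums (1 / (1 - 1 / 4))" by (rule geometric_sums) simp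
    from sums_divide[OF this, of 256] show ?thesis by (simp add: r_def[abs_def])
  qed
  have "ennreal 1 = emeasure lebesgue {0..<1::real}" by simp
  also have "\<dots> \<le> emeasure lebesgue (Z \<union> (\<Union>i. T i))"
    using cover T(1) Z by (intro emeasure_mono) auto
  also have "\<dots> = emeasure lebesgue (\<Union>i. T i)"
    using T(1) Z emeasure_Un_null_set[of "\<Union>i. T i" lebesgue Z] by (simp add: Un_commute)
  also have "\<dots> \<le> (\<Sum>i. emeasure lebesgue (T i))"
    using T(1) by (intro emeasure_subadditive_countably) auto
  also have "\<dots> \<le> (\<Sum>i. ennreal (80 / 9 * r i))"
    using T(3) by (intro suminf_le) (auto simp: mult.assoc[symmetric])
  also have "\<dots> = ennreal (80 / 9 * (1 / 192))"
    using sums_mult[OF sums, of "80 / 9"]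
    by (subst suminf_ennreal2) (auto simp: r_def sums_iff)
  finally show False by simp
qed

theorem corollary5p2:
  fixes \<epsilon> :: real
  assumes "0 < \<epsilon>" and "\<epsilon> < 1 / 100"
  shows "\<not> weak_locally_H1_finite (A_eps \<epsilon>) \<and> \<not> weak_locally_H1_finite (calA_eps \<epsilon>)"
proof -
  have "\<not> weak_locally_H1_finite (calA_eps \<epsilon>)"
    using negligible_preimage_weak_locally_H1_finite[OF negligible_limit_point_preimage[OF assms]]
      not_negligible_calA_eps_preimage[OF assms] by blast
  moreover have "calA_eps \<epsilon> \<subseteq> A_eps \<epsilon>" by (auto simp: calA_eps_def)
  ultimately show ?thesis using weak_locally_H1_finite_subset by blast
qed

end
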